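(* Let $g:\mathbb{R}^{n+m}\to\mathbb{R}_+$ be the joint probability density function of $(X_{1:n}(T),Y_{1:m}(T))$, and let $$C(S(0),V(0))=e^{-rT}\,\mathbb{E}\big[G\big(T,X_1(T)+\zeta_1(S(0)),X_{2:n}(T),Y_1(T)+\zeta_2(V(0)),Y_{2:m}(T)\big)\big].$$ (I) Assume that the following hold: (i) the function $z\mapsto g(x_1-z,x_{2:n},y_{1:m})$ is differentiable almost everywhere; (ii) $\mathbb{E}\big[\big|G\big(T,X_1(T)+z+\zeta_1(S(0)),X_{2:n}(T),Y_1(T)+\zeta_2(V(0)),Y_{2:m}(T)\big)\big|^2\big]^{1/2}<\infty$; (iii) there exists an integrable function $\phi\in L^1(\mathbb{R}^{n+m})$ such that for all $z$ in a neighbourhood of interest, $$\Big|G\big(T,x_1+\zeta_1(S(0)),x_{2:n},y_1+\zeta_2(V(0)),y_{2:m}\big)\,\frac{\partial}{\partial x_1}g(x_1-z,x_{2:n},y_{1:m})\Big|\le\phi(x_{1:n},y_{1:m}).$$ Then the delta with respect to the price is given by $$\Delta_S=\frac{\partial C}{\partial S(0)}=-\zeta_1'(S(0))e^{-rT}\,\mathbb{E}\Big[G\big(T,X_1(T)+\zeta_1(S(0)),X_{2:n}(T),Y_1(T)+\zeta_2(V(0)),Y_{2:m}(T)\big)\,\frac{\partial}{\partial x_1}\ln g\big(X_{1:n}(T),Y_{1:m}(T)\big)\Big].$$ (II) Assume that the following hold: (i) the function $z\mapsto g(x_{1:n},y_1-z,y_{2:m})$ is differentiable almost everywhere; (ii)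 $\mathbb{E}\big[\big|G\big(T,X_1(T)+\zeta_1(S(0)),X_{2:n}(T),Y_1(T)+z+\zeta_2(V(0)),Y_{2:m}(T)\big)\big|^2\big]^{1/2}<\infty$; (iii) there exists an integrable function $\phi\in L^1(\mathbb{R}^{n+m})$ such that for all $z$ in a neighbourhood of interest, $$\Big|G\big(T,x_1+\zeta_1(S(0)),x_{2:n},y_1+\zeta_2(V(0)),y_{2:m}\big)\,\frac{\partial}{\partial y_1}g(x_{1:n},y_1-z,y_{2:m})\Big|\le\phi(x_{1:n},y_{1:m}).$$ Then the delta with respect to the volume is given by $$\Delta_V=\frac{\partial C}{\partial V(0)}=-\zeta_2'(V(0))e^{-rT}\,\mathbb{E}\Big[G\big(T,X_1(T)+\zeta_1(S(0)),X_{2:n}(T),Y_1(T)+\zeta_2(V(0)),Y_{2:m}(T)\big)\,\frac{\partial}{\partial y_1}\ln g\big(X_{1:n}(T),Y_{1:m}(T)\big)\Big].$$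
   Context: Setting: $(\Omega,\mathcal{F},(\mathcal{F}_t)_{0\le t\le T},\mathbb{Q})$ is a filtered probability space with finite time horizon $T$, $\mathbb{E}$ is expectation under the pricing measure $\mathbb{Q}$, and $r>0$ is the constant risk-free interest rate. $X_1,\dots,X_n$ and $Y_1,\dots,Y_m$ are adapted stochastic processes; price and volume factors may be dependent. Notation: $x_{i:n}=(x_i,\dots,x_n)$, $y_{j:m}=(y_j,\dots,y_m)$, $X_{i:n}(T)=(X_i(T),\dots,X_n(T))$, $Y_{j:m}(T)=(Y_j(T),\dots,Y_m(T))$. The energy spot price and the volume are $S(t)=h_1(t,X_1(t)+\zeta_1(S(0)),X_2(t),\dots,X_n(t))$ and $V(t)=h_2(t,Y_1(t)+\zeta_2(V(0)),Y_2(t),\dots,Y_m(t))$, $0\le t\le T$, where $\zeta_1,\zeta_2$ are differentiable functions and $h_1:\mathbb{R}^{n+1}\to\mathbb{R}$, $h_2:\mathbb{R}^{m+1}\to\mathbb{R}$ are Borel measurable. The set-up notes that, with $x=S(0)$ and $v=V(0)$, $x=h_1(0,X_1(0)+\zeta_1(x),X_2(0),\dots,X_n(0))$ where $X_1(0)=x$, $X_2(0)=\dots=X_n(0)=0$, and $v=h_2(0,Y_1(0)+\zeta_2(v),Y_2(0),\dots,Y_m(0))$ where $Y_1(0)=v$, $Y_2(0)=\dots=Y_m(0)=0$. For a Borel measurable payoff $h:\mathbb{R}\times\mathbb{R}\to\mathbb{R}$ with $\mathbb{E}[|h(S(T),V(T))|^2]<\infty$, $G$ denotes the payoff re-expressed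 in the factors: $h(S(T),V(T))=G(T,X_1(T)+\zeta_1(S(0)),X_{2:n}(T),Y_1(T)+\zeta_2(V(0)),Y_{2:m}(T))$. Thus $C(S(0),V(0))=e^{-rT}\mathbb{E}[h(S(T),V(T))]$ is the arbitrage-free option price at time zero. The derivative $\frac{\partial}{\partial x_1}\ln g$ means $\big(\frac{\partial}{\partial x_1}g\big)/g$, and similarly for $y_1$. *)

theory Defs
  imports "HOL-Probability.Probability"
begin

locale filtered_prob_space = prob_space Q for Q :: "'a measure" +
  fixes F :: "real \<Rightarrow> 'a measure" and T :: real
  assumes horizon_pos: "0 < T"
    and subalgebra_F: "\<And>t. t \<in> {0..T} \<Longrightarrow> subalgebra Q (F t)"
    and sets_F_mono: "\<And>s t. 0 \<le> s \<Longrightarrow> s \<le> t \<Longrightarrow> t \<le> T \<Longrightarrow> sets (F s) \<subseteq> sets (F t)"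

text \<open>
  The price factors form a vector in \<open>real ^ 'n\<close> and the volume factors one in \<open>real ^ 'm\<close>, with
  \<open>'n, 'm :: {finite, one}\<close>. The class \<open>one\<close> has no axioms; it only names the coordinate \<open>1\<close> that
  carries the shifts. Thus \<open>x + axis 1 z\<close> is $(x_1 + z, x_2, \dots, x_n)$.

  The two partial derivatives of a density in its first price and its first volume coordinate.
  Where such a derivative does not exist, \<open>deriv\<close> has an unspecified value.
\<close>

definition partial_x1 ::
  "((real ^ 'n::{finite,one}) \<times> (real ^ 'm::{finite,one}) \<Rightarrow> real) \<Rightarrow>
    (real ^ 'n::{finite,one}) \<times> (real ^ 'm::{finite,one}) \<Rightarrow> real"
  where "partial_x1 g = (\<lambda>(x, y). deriv (\<lambda>u. g (x + axis 1 u, y)) 0)"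

definition partial_y1 ::
  "((real ^ 'n::{finite,one}) \<times> (real ^ 'm::{finite,one}) \<Rightarrow> real) \<Rightarrow>
    (real ^ 'n::{finite,one}) \<times> (real ^ 'm::{finite,one}) \<Rightarrow> real"
  where "partial_y1 g = (\<lambda>(x, y). deriv (\<lambda>u. g (x, y + axis 1 u)) 0)"

text \<open>
  The logarithmic derivatives are quotients, so that \<open>g\<close> may vanish (on a set that the random
  vector with density \<open>g\<close> almost surely avoids).
\<close>

definition partial_ln_x1 ::
  "((real ^ 'n::{finite,one}) \<times> (real ^ 'm::{finite,one}) \<Rightarrow> real) \<Rightarrow>
    (real ^ 'n::{finite,one}) \<times> (real ^ 'm::{finite,one}) \<Rightarrow> real"
  where "partial_ln_x1 g p = partial_x1 g p / g p"

definition partial_ln_y1 ::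
  "((real ^ 'n::{finite,one}) \<times> (real ^ 'm::{finite,one}) \<Rightarrow> real) \<Rightarrow>
    (real ^ 'n::{finite,one}) \<times> (real ^ 'm::{finite,one}) \<Rightarrow> real"
  where "partial_ln_y1 g p = partial_y1 g p / g p"

text \<open>
  Expectation of a random variable that is defined only almost surely, such as the logarithmic
  derivative of a density at the random vector. The exceptional null set need not be an event, so
  the integral is taken over the completion; on random variables it agrees with the ordinary
  expectation (\<open>integral_completion\<close>).
\<close>

definition expectation_as :: "'a measure \<Rightarrow> ('a \<Rightarrow> real) \<Rightarrow> real"
  where "expectation_as Q Z = integral\<^sup>L (completion Q) Z"

end

theory Submission
  imports Defs
begin

text \<open>
  The shift of the initial value can be moved from the payoff to the density: by translation
  invariance of Lebesgue measure the expectation of \<open>H (Z + z e)\<close> is the integral of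
  \<open>H p * g (p - z e)\<close>. Its derivative in \<open>z\<close> is taken under the integral sign by dominated
  convergence (the mean value theorem turns the bound on the derivative into one on the difference
  quotients), and the chain rule brings in the derivative of the shift. Dividing and multiplying by
  \<open>g\<close> is harmless, because a nonnegative function has derivative 0 at its zeros.
\<close>

section \<open>Derivatives of a density along a line\<close>

text \<open>A free direction \<open>e\<close> lets price and volume share one argument:
  \<open>partial_x1\<close> and \<open>partial_y1\<close> are the cases \<open>(axis 1 1, 0)\<close>
  and \<open>(0, axis 1 1)\<close>.\<close>

definition line_deriv :: "'e::real_vector \<Rightarrow> ('e \<Rightarrow> real) \<Rightarrow> 'e \<Rightarrow> real"
  where "line_deriv e g p = deriv (\<lambda>u. g (p + u *\<^sub>R e)) 0"

text \<open>Walking along \<open>- e\<close> reverses the sign; the minus sign of both deltas starts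
  here. Substituting \<open>z - u\<close> for \<open>z\<close> moves the point of differentiation to
  \<open>u = 0\<close>, as in the definition of \<open>line_deriv\<close>.\<close>

lemma has_derivative_line_deriv:
  assumes "(\<lambda>z. g (p - z *\<^sub>R e)) differentiable (at z)"
  shows "((\<lambda>z. g (p - z *\<^sub>R e)) has_real_derivative - line_deriv e g (p - z *\<^sub>R e)) (at z)"
proof -
  obtain l where l: "((\<lambda>z. g (p - z *\<^sub>R e)) has_real_derivative l) (at z)"
    using assms by (auto simp: real_differentiable_def)
  have "((\<lambda>u. g (p - (z - u) *\<^sub>R e)) has_real_derivative l * (0 - 1)) (at 0)"
    by (rule DERIV_chain'[where f = "\<lambda>u. z - u" and g = "\<lambda>z. g (p - z *\<^sub>R e)"])
      (use l in \<open>auto intro!: derivative_eq_intros\<close>)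
  then have "line_deriv e g (p - z *\<^sub>R e) = - l"
    unfolding line_deriv_def by (intro DERIV_imp_deriv) (simp add: algebra_simps)
  with l show ?thesis by simp
qed

lemma line_deriv_eq_0:
  assumes "(\<lambda>z. g (p - z *\<^sub>R e)) differentiable (at 0)" "\<And>q. g q \<ge> 0" "g p = 0"
  shows "line_deriv e g p = 0"
  \<comment> \<open>A zero of \<open>g\<close> is a global minimum, so any positive radius would do
    in place of 1.\<close>
  using DERIV_local_min[OF has_derivative_line_deriv[OF assms(1)], of 1] assms(2,3) by simp

text \<open>Whether the derivative exists depends on uncountably many quotients, so it is unclear
  whether \<open>line_deriv\<close> is Borel. The limit along one fixed null sequence involves only
  countably many; it is Borel everywhere and has the right value wherever the derivative
  exists.\<close>

lemma line_deriv_borel_representative: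
  fixes g :: "'e::euclidean_space \<Rightarrow> real"
  assumes [measurable]: "g \<in> borel_measurable borel"
  shows "\<exists>D \<in> borel_measurable borel.
    \<forall>p. (\<lambda>z. g (p - z *\<^sub>R e)) differentiable (at 0) \<longrightarrow> D p = line_deriv e g p"
proof (intro bexI allI impI)
  \<comment> \<open>The quotients step along \<open>- e\<close>; the outer minus corrects the
    sign.\<close>
  let ?q = "\<lambda>i p. - ((g (p - inverse (real (Suc i)) *\<^sub>R e) - g p) / inverse (real (Suc i)))"
  show "(\<lambda>p. lim (\<lambda>i. ?q i p)) \<in> borel_measurable borel"
    by measurable
  fix p assume "(\<lambda>z. g (p - z *\<^sub>R e)) differentiable (at 0)"
  from has_derivative_line_deriv[OF this]
  have "((\<lambda>h. (g (p - h *\<^sub>R e) - g p) / h) \<longlongrightarrow> - line_deriv e g p) (at 0)"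
    by (simp add: DERIV_def)
  moreover have "filterlim (\<lambda>i. inverse (real (Suc i))) (at 0) sequentially"
    using LIMSEQ_inverse_real_of_nat by (auto simp: filterlim_at)
  ultimately have "(\<lambda>i. (g (p - inverse (real (Suc i)) *\<^sub>R e) - g p) / inverse (real (Suc i)))
      \<longlonglongrightarrow> - line_deriv e g p"
    by (rule filterlim_compose)
  from tendsto_minus[OF this] show "lim (\<lambda>i. ?q i p) = line_deriv e g p"
    by (intro limI) simp
qed

section \<open>Differentiation under the integral sign\<close>

text \<open>The mean value inequality on the convex set \<open>ball 0 d\<close>. It is applied with
  \<open>B\<close> equal to \<open>\<phi> p\<close>, so that one integrable function dominates the
  quotients for all small \<open>z\<close>.\<close>

lemma difference_quotient_bound:
  fixes f :: "real \<Rightarrow> real"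
  assumes "\<And>w. \<bar>w\<bar> < d \<Longrightarrow> (f has_real_derivative f' w) (at w)"
    and "\<And>w. \<bar>w\<bar> < d \<Longrightarrow> \<bar>f' w\<bar> \<le> B" and "\<bar>z\<bar> < d" "z \<noteq> 0"
  shows "\<bar>(f z - f 0) / z\<bar> \<le> B"
proof -
  have "norm (f z - f 0) \<le> B * norm (z - 0)"
    by (rule field_differentiable_bound[of "ball 0 d" f f'])
      (use assms in \<open>auto intro: has_field_derivative_at_within\<close>)
  then show ?thesis using assms(4) by (simp add: divide_simps)
qed

text \<open>\<open>D\<close> stands for the derivative at \<open>z = 0\<close> wherever
  measurability is required. The quantifier over \<open>U\<close> is inside \<open>AE\<close>: the
  mean value theorem is used for a fixed \<open>p\<close> along a whole segment of shifts, so the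
  exceptional null set must be the same for all of them.\<close>

lemma shifted_integral_has_derivative:
  fixes g H D \<phi> :: "'e::euclidean_space \<Rightarrow> real"
  assumes [measurable]: "g \<in> borel_measurable borel" "H \<in> borel_measurable borel"
      "D \<in> borel_measurable borel"
    and D: "AE p in lborel. D p = line_deriv e g p"
    and U: "open U" "0 \<in> U" and \<phi>: "integrable lborel \<phi>"
    and diff: "AE p in lborel. \<forall>z\<in>U. (\<lambda>z. g (p - z *\<^sub>R e)) differentiable (at z)"
    and int: "\<And>z. z \<in> U \<Longrightarrow> integrable lborel (\<lambda>p. H p * g (p - z *\<^sub>R e))"
    and bound: "AE p in lborel. \<forall>z\<in>U. \<bar>H p * line_deriv e g (p - z *\<^sub>R e)\<bar> \<le> \<phi> p"
  shows "integrable lborel (\<lambda>p. H p * D p)"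
    and "((\<lambda>z. \<integral>p. H p * g (p - z *\<^sub>R e) \<partial>lborel) has_real_derivative
      - (\<integral>p. H p * D p \<partial>lborel)) (at 0)"
proof -
  show "integrable lborel (\<lambda>p. H p * D p)"
  proof (rule Bochner_Integration.integrable_bound[OF \<phi>])
    \<comment> \<open>This is \<open>bound\<close> at \<open>z = 0\<close>.\<close>
    show "AE p in lborel. norm (H p * D p) \<le> norm (\<phi> p)"
      using D bound by eventually_elim (use U in force)
  qed measurable
  obtain d where d: "d > 0" "ball 0 d \<subseteq> U"
    using U by (auto simp: open_contains_ball)
  let ?F = "\<lambda>z. \<integral>p. H p * g (p - z *\<^sub>R e) \<partial>lborel"
  let ?q = "\<lambda>z p. H p * ((g (p - z *\<^sub>R e) - g p) / z)"
  have F: "(?F z - ?F 0) / z = (\<integral>p. ?q z p \<partial>lborel)" if "\<bar>z\<bar> < d" for z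
  proof -
    have "z \<in> U" using that d by auto
    then have "?F z - ?F 0 = (\<integral>p. H p * g (p - z *\<^sub>R e) - H p * g (p - 0 *\<^sub>R e) \<partial>lborel)"
      using int U by (intro Bochner_Integration.integral_diff[symmetric]) blast+
    then have "(?F z - ?F 0) / z =
        (\<integral>p. (H p * g (p - z *\<^sub>R e) - H p * g (p - 0 *\<^sub>R e)) / z \<partial>lborel)"
      by simp
    also have "\<dots> = (\<integral>p. ?q z p \<partial>lborel)"
      by (intro Bochner_Integration.integral_cong) (auto simp: right_diff_distrib)
    finally show ?thesis .
  qed
  \<comment> \<open>Dominated convergence is a statement about sequences, so the limit is tested
    along every sequence of nonzero shifts tending to 0.\<close>
  have "((\<lambda>z. \<integral>p. ?q z p \<partial>lborel) \<longlongrightarrow> (\<integral>p. - (H p * D p) \<partial>lborel)) (at 0)"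
    unfolding tendsto_at_iff_sequentially comp_def
  proof (intro allI impI)
    fix Z :: "nat \<Rightarrow> real" assume Z: "\<forall>i. Z i \<in> UNIV - {0}" "Z \<longlonglongrightarrow> 0"
    then have lim: "filterlim Z (at 0) sequentially" by (simp add: filterlim_at)
    have "eventually (\<lambda>i. \<bar>Z i\<bar> < d) sequentially"
      using Z(2) d(1) by (auto simp: tendsto_iff dist_real_def)
    then obtain N where N: "\<And>i. i \<ge> N \<Longrightarrow> \<bar>Z i\<bar> < d"
      by (auto simp: eventually_sequentially)
    show "(\<lambda>i. \<integral>p. ?q (Z i) p \<partial>lborel) \<longlonglongrightarrow> (\<integral>p. - (H p * D p) \<partial>lborel)"
    \<comment> \<open>The domination has to hold at every index, but is known only once
      \<open>Z i\<close> lies in the ball; the first \<open>N\<close> terms are therefore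
      dropped.\<close>
    proof (rule LIMSEQ_offset[of _ N], rule integral_dominated_convergence[OF _ _ \<phi>])
      show "AE p in lborel. (\<lambda>i. ?q (Z (i + N)) p) \<longlonglongrightarrow> - (H p * D p)"
        using D diff
      proof eventually_elim
        case (elim p)
        have "((\<lambda>h. (g (p - h *\<^sub>R e) - g p) / h) \<longlongrightarrow> - D p) (at 0)"
          using has_derivative_line_deriv[of g p e 0] elim U by (simp add: DERIV_def)
        from tendsto_mult[OF tendsto_const filterlim_compose[OF this lim], of "H p"]
        show ?case by (intro LIMSEQ_ignore_initial_segment[where k = N]) simp
      qed
      show "AE p in lborel. norm (?q (Z (i + N)) p) \<le> \<phi> p" for i
        using diff bound
      proof eventually_elim
        case (elim p)
        let ?f = "\<lambda>z. H p * g (p - z *\<^sub>R e)"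
        have "\<bar>(?f (Z (i + N)) - ?f 0) / Z (i + N)\<bar> \<le> \<phi> p"
        proof (rule difference_quotient_bound)
          fix w assume "\<bar>w\<bar> < d"
          then have w: "w \<in> U" using d by auto
          show "(?f has_real_derivative - (H p * line_deriv e g (p - w *\<^sub>R e))) (at w)"
            using DERIV_cmult[OF has_derivative_line_deriv[of g p e w], of "H p"] elim(1) w by simp
          show "\<bar>- (H p * line_deriv e g (p - w *\<^sub>R e))\<bar> \<le> \<phi> p"
            using elim(2) w by simp
        qed (use N Z in auto)
        then show ?case by (simp add: right_diff_distrib)
      qed
    qed measurable
  qed
  \<comment> \<open>\<open>F\<close> covers only shifts below \<open>d\<close>, which is enough for
    a limit at 0.\<close>
  moreover have "eventually (\<lambda>z. (?F z - ?F 0) / z = (\<integral>p. ?q z p \<partial>lborel)) (at 0)"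
    unfolding eventually_at using d(1) F by (intro exI[of _ d]) (auto simp: dist_real_def)
  ultimately have "((\<lambda>z. (?F z - ?F 0) / (z - 0)) \<longlongrightarrow> (\<integral>p. - (H p * D p) \<partial>lborel)) (at 0)"
    unfolding diff_0_right by (subst tendsto_cong)
  then show "(?F has_real_derivative - (\<integral>p. H p * D p \<partial>lborel)) (at 0)"
    unfolding has_field_derivative_iff by simp
qed

section \<open>Transfer between a random vector and its density\<close>

text \<open>The law of \<open>Z\<close> is \<open>density lborel f\<close>, which gives no mass to
  Lebesgue null sets or to the zero set of \<open>f\<close>.\<close>

lemma distributed_AE_lborel:
  fixes Z :: "'a \<Rightarrow> 'e::euclidean_space"
  assumes Z: "distributed M lborel Z f" and P: "AE p in lborel. P p"
  shows "AE \<omega> in M. f (Z \<omega>) \<noteq> 0 \<and> P (Z \<omega>)"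
proof -
  have [measurable]: "Z \<in> borel_measurable M" "f \<in> borel_measurable borel"
    using distributed_measurable[OF Z] distributed_borel_measurable[OF Z] by simp_all
  have "AE p in density lborel f. f p \<noteq> 0 \<and> P p"
    using P by (subst AE_density) (auto elim!: eventually_mono simp: zero_less_iff_neq_zero)
  then show ?thesis
    unfolding distributed_distr_eq_density[OF Z, symmetric]
    by (rule AE_distrD[rotated]) simp
qed

text \<open>Writing \<open>lborel\<close> as its own image under translation by \<open>a\<close>
  moves the shift from \<open>H\<close> to \<open>g\<close>. The payoff can thus be discontinuous:
  only the density will be differentiated.\<close>

lemma distributed_integral_translate:
  fixes Z :: "'a \<Rightarrow> 'e::euclidean_space" and g H :: "'e \<Rightarrow> real"
  assumes Z: "distributed M lborel Z (\<lambda>p. ennreal (g p))" and g: "\<And>p. g p \<ge> 0"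
    and [measurable]: "H \<in> borel_measurable borel"
  shows "(\<integral>\<omega>. H (Z \<omega> + a) \<partial>M) = (\<integral>p. H p * g (p - a) \<partial>lborel)"
    and "integrable M (\<lambda>\<omega>. H (Z \<omega> + a)) \<longleftrightarrow> integrable lborel (\<lambda>p. H p * g (p - a))"
proof -
  have [measurable]: "g \<in> borel_measurable borel"
    using distributed_real_measurable[OF g Z] by simp
  have lb: "lborel = distr lborel borel ((+) a)"
    by (rule lborel_distr_plus[symmetric])
  show "(\<integral>\<omega>. H (Z \<omega> + a) \<partial>M) = (\<integral>p. H p * g (p - a) \<partial>lborel)"
    by (subst lb, subst integral_distr, simp, simp,
        subst distributed_integral[OF Z, symmetric]) (auto simp: g ac_simps)
  show "integrable M (\<lambda>\<omega>. H (Z \<omega> + a)) \<longleftrightarrow> integrable lborel (\<lambda>p. H p * g (p - a))"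
    by (subst lb, subst integrable_distr_eq, simp, simp,
        subst distributed_integrable[OF Z, symmetric]) (auto simp: g ac_simps)
qed

text \<open>\<open>f'\<close> need not be measurable for \<open>M\<close>. Its preimages differ from
  those of \<open>f\<close> only inside a null set, and every subset of a null set is an event of
  the completion.\<close>

lemma expectation_as_cong_AE:
  assumes [measurable]: "f \<in> borel_measurable M" and "AE \<omega> in M. f \<omega> = f' \<omega>"
  shows "expectation_as M f' = (\<integral>\<omega>. f \<omega> \<partial>M)"
    and "integrable (completion M) f' \<longleftrightarrow> integrable M f"
proof -
  have f: "f \<in> borel_measurable (completion M)"
    by (rule measurable_completion) simp
  have AE: "AE \<omega> in completion M. f \<omega> = f' \<omega>"
    using assms(2) by (rule AE_completion)
  have f': "f' \<in> borel_measurable (completion M)"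
  proof (rule measurableI)
    fix A :: "real set" assume "A \<in> sets borel"
    then show "f' -` A \<inter> space (completion M) \<in> sets (completion M)"
      using AE by (intro completion.in_sets_AE[OF _ measurable_sets[OF f]])
        (auto elim!: eventually_mono simp: AE_completion_iff intro: AE_I2)
  qed simp
  show "expectation_as M f' = (\<integral>\<omega>. f \<omega> \<partial>M)"
    unfolding expectation_as_def using integral_cong_AE[OF f f' AE]
    by (simp add: integral_completion)
  show "integrable (completion M) f' \<longleftrightarrow> integrable M f"
    using integrable_cong_AE[OF f f' AE] by (simp add: integrable_completion)
qed

section \<open>The derivative of a shifted expectation\<close>

text \<open>All integrals are computed with a Borel version \<open>D\<close> of the derivative. Only
  at the end is \<open>D\<close> exchanged, almost surely, for the \<open>line_deriv\<close> in
  \<open>W\<close>, which is where the completion enters.\<close>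

lemma (in prob_space) shifted_expectation_has_derivative:
  fixes Z :: "'a \<Rightarrow> 'e::euclidean_space" and g H \<phi> :: "'e \<Rightarrow> real"
  assumes Z: "distributed M lborel Z (\<lambda>p. ennreal (g p))" and g: "\<And>p. g p \<ge> 0"
    and H[measurable]: "H \<in> borel_measurable borel"
    and U: "open U" "0 \<in> U" and \<phi>: "integrable lborel \<phi>"
    and diff: "AE p in lborel. \<forall>z\<in>U. (\<lambda>z. g (p - z *\<^sub>R e)) differentiable (at z)"
    and L2: "\<forall>z\<in>U. integrable M (\<lambda>\<omega>. \<bar>H (Z \<omega> + z *\<^sub>R e)\<bar>\<^sup>2)"
    and bound: "AE p in lborel. \<forall>z\<in>U. \<bar>H p * line_deriv e g (p - z *\<^sub>R e)\<bar> \<le> \<phi> p"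
  defines "W \<equiv> \<lambda>\<omega>. H (Z \<omega>) * (line_deriv e g (Z \<omega>) / g (Z \<omega>))"
  shows "integrable (completion M) W"
    and "((\<lambda>z. expectation (\<lambda>\<omega>. H (Z \<omega> + z *\<^sub>R e))) has_real_derivative - expectation_as M W) (at 0)"
proof -
  have g_meas[measurable]: "g \<in> borel_measurable borel"
    using distributed_real_measurable[OF g Z] by simp
  have [measurable]: "Z \<in> borel_measurable M"
    using distributed_measurable[OF Z] by simp
  obtain D where D_meas[measurable]: "D \<in> borel_measurable borel"
    and D: "\<And>p. (\<lambda>z. g (p - z *\<^sub>R e)) differentiable (at 0) \<Longrightarrow> D p = line_deriv e g p"
    using line_deriv_borel_representative[OF g_meas] by metis
  have D_AE: "AE p in lborel. D p = line_deriv e g p"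
    using diff by eventually_elim (use U D in blast)
  \<comment> \<open>Square integrability implies integrability because \<open>M\<close> is finite;
    translation then turns this into integrability against the shifted density.\<close>
  have "integrable lborel (\<lambda>p. H p * g (p - z *\<^sub>R e))" if "z \<in> U" for z
  proof -
    have "integrable M (\<lambda>\<omega>. (H (Z \<omega> + z *\<^sub>R e))\<^sup>2)"
      using L2 that by simp
    then have "integrable M (\<lambda>\<omega>. H (Z \<omega> + z *\<^sub>R e))"
      by (rule square_integrable_imp_integrable[rotated]) measurable
    then show ?thesis
      by (rule distributed_integral_translate(2)[OF Z g H, THEN iffD1])
  qed
  note der = shifted_integral_has_derivative[OF g_meas H D_meas D_AE U \<phi> diff this bound]
  \<comment> \<open>Where \<open>g p = 0\<close>, the left side is 0 and the right side vanishes
    because \<open>D p\<close> is the derivative at a minimum.\<close>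
  have HD: "AE p in lborel. g p * (H p * (D p / g p)) = H p * D p"
    using diff
  proof eventually_elim
    case (elim p)
    then have "(\<lambda>z. g (p - z *\<^sub>R e)) differentiable (at 0)" using U by blast
    then show ?case using D line_deriv_eq_0[of g p e] g by (cases "g p = 0") auto
  qed
  have "integrable lborel (\<lambda>p. g p * (H p * (D p / g p)))"
    using der(1) HD by (subst integrable_cong_AE[OF _ _ HD]) auto
  then have int: "integrable M (\<lambda>\<omega>. H (Z \<omega>) * (D (Z \<omega>) / g (Z \<omega>)))"
    by (subst (asm) distributed_integrable[OF Z]) (auto simp: g)
  have eq: "expectation (\<lambda>\<omega>. H (Z \<omega>) * (D (Z \<omega>) / g (Z \<omega>))) = (\<integral>p. H p * D p \<partial>lborel)"
    by (subst distributed_integral[OF Z, symmetric], simp, rule g, rule integral_cong_AE[OF _ _ HD])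
      measurable
  have W: "AE \<omega> in M. H (Z \<omega>) * (D (Z \<omega>) / g (Z \<omega>)) = W \<omega>"
    using distributed_AE_lborel[OF Z D_AE] by eventually_elim (simp add: W_def)
  note W_eq = expectation_as_cong_AE[OF _ W]
  show "integrable (completion M) W"
    using W_eq(2) int by simp
  show "((\<lambda>z. expectation (\<lambda>\<omega>. H (Z \<omega> + z *\<^sub>R e))) has_real_derivative - expectation_as M W) (at 0)"
    using der(2) W_eq(1) eq unfolding distributed_integral_translate(1)[OF Z g H] by simp
qed

section \<open>The chain rule and the two coordinate directions\<close>

text \<open>The increment of \<open>\<zeta>\<close> vanishes at \<open>s0\<close>, so the derivative
  of \<open>E\<close> is needed only at 0. The constant \<open>c\<close> will be the discount
  factor.\<close>

lemma has_derivative_scaled_shift: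
  fixes \<zeta> E :: "real \<Rightarrow> real"
  assumes "\<zeta> differentiable (at s0)" and "(E has_real_derivative - A) (at 0)"
  shows "((\<lambda>s. c * E (\<zeta> s - \<zeta> s0)) has_real_derivative - deriv \<zeta> s0 * c * A) (at s0)"
proof -
  have "(\<zeta> has_real_derivative deriv \<zeta> s0) (at s0)"
    using assms(1) by (simp add: DERIV_deriv_iff_real_differentiable)
  then have "((\<lambda>s. \<zeta> s - \<zeta> s0) has_real_derivative deriv \<zeta> s0) (at s0)"
    by (auto intro!: derivative_eq_intros)
  then have "((\<lambda>s. E (\<zeta> s - \<zeta> s0)) has_real_derivative - A * deriv \<zeta> s0) (at s0)"
    using assms(2) by (intro DERIV_chain'[where g = E]) auto
  from DERIV_cmult[OF this, of c] show ?thesis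
    by (simp add: mult_ac)
qed

lemma axis_one_scaleR: "u *\<^sub>R axis 1 (1::real) = axis 1 u"
  by (simp add: axis_def vec_eq_iff)

lemma axis_add: "axis i (u + v :: real) = axis i u + axis i v"
  by (simp add: axis_def vec_eq_iff)

lemma partial_x1_eq_line_deriv:
  fixes g :: "(real ^ 'n::{finite,one}) \<times> (real ^ 'm::{finite,one}) \<Rightarrow> real"
  shows "partial_x1 g = line_deriv (axis 1 1, 0) g"
  by (auto simp: fun_eq_iff partial_x1_def line_deriv_def axis_one_scaleR)

lemma partial_y1_eq_line_deriv:
  fixes g :: "(real ^ 'n::{finite,one}) \<times> (real ^ 'm::{finite,one}) \<Rightarrow> real"
  shows "partial_y1 g = line_deriv (0, axis 1 1) g"
  by (auto simp: fun_eq_iff partial_y1_def line_deriv_def axis_one_scaleR)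

section \<open>The deltas with respect to price and volume\<close>

text \<open>The neighbourhood \<open>U\<close> is one of 0 because it contains the increments of
  \<open>\<zeta>1\<close> or \<open>\<zeta>2\<close> near the initial value. Integrability is
  asserted along with each derivative, since the Bochner integral of a nonintegrable function is 0
  by convention and the formula alone would not exclude that case.\<close>

theorem proposition2p1:
  fixes Q :: "'a measure"
    and F :: "real \<Rightarrow> 'a measure"
    and T r s0 v0 :: real
    and X :: "real \<Rightarrow> 'a \<Rightarrow> real ^ 'n::{finite,one}"
    and Y :: "real \<Rightarrow> 'a \<Rightarrow> real ^ 'm::{finite,one}"
    and \<zeta>1 \<zeta>2 :: "real \<Rightarrow> real"
    and h1 :: "real \<times> (real ^ 'n::{finite,one}) \<Rightarrow> real"
    and h2 :: "real \<times> (real ^ 'm::{finite,one}) \<Rightarrow> real"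
    and h :: "real \<times> real \<Rightarrow> real"
    and S V :: "real \<Rightarrow> 'a \<Rightarrow> real"
    and G :: "real \<Rightarrow> real ^ 'n::{finite,one} \<Rightarrow> real ^ 'm::{finite,one} \<Rightarrow> real"
    and C :: "real \<Rightarrow> real \<Rightarrow> real"
    and g :: "(real ^ 'n::{finite,one}) \<times> (real ^ 'm::{finite,one}) \<Rightarrow> real"
  assumes filtered: "filtered_prob_space Q F T"
    and rate: "r > 0"
    and X_adapted: "\<And>t. t \<in> {0..T} \<Longrightarrow> X t \<in> borel_measurable (F t)"
    and Y_adapted: "\<And>t. t \<in> {0..T} \<Longrightarrow> Y t \<in> borel_measurable (F t)"
    and \<zeta>1_diff: "\<And>s. \<zeta>1 differentiable (at s)"
    and \<zeta>2_diff: "\<And>v. \<zeta>2 differentiable (at v)"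
    and h1_borel: "h1 \<in> borel_measurable borel"
    and h2_borel: "h2 \<in> borel_measurable borel"
    and S_def: "\<And>t \<omega>. t \<in> {0..T} \<Longrightarrow> S t \<omega> = h1 (t, X t \<omega> + axis 1 (\<zeta>1 s0))"
    and V_def: "\<And>t \<omega>. t \<in> {0..T} \<Longrightarrow> V t \<omega> = h2 (t, Y t \<omega> + axis 1 (\<zeta>2 v0))"
    and X_initial: "AE \<omega> in Q. X 0 \<omega> = axis 1 s0"
    and Y_initial: "AE \<omega> in Q. Y 0 \<omega> = axis 1 v0"
    and S_initial: "AE \<omega> in Q. S 0 \<omega> = s0"
    and V_initial: "AE \<omega> in Q. V 0 \<omega> = v0"
    and h_borel: "h \<in> borel_measurable borel"
    and h_L2: "integrable Q (\<lambda>\<omega>. \<bar>h (S T \<omega>, V T \<omega>)\<bar>\<^sup>2)"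
    and G_def: "\<And>t x y. G t x y = h (h1 (t, x), h2 (t, y))"
    and C_def: "\<And>s v. C s v =
      exp (- r * T) * (\<integral>\<omega>. G T (X T \<omega> + axis 1 (\<zeta>1 s)) (Y T \<omega> + axis 1 (\<zeta>2 v)) \<partial>Q)"
    and g_nonneg: "\<And>p. g p \<ge> 0"
    and g_density: "distributed Q lborel (\<lambda>\<omega>. (X T \<omega>, Y T \<omega>)) (\<lambda>p. ennreal (g p))"
  shows
    "((\<exists>U \<phi>. open U \<and> 0 \<in> U \<and> integrable lborel \<phi> \<and>
        (AE (x, y) in lborel. \<forall>z\<in>U. (\<lambda>z. g (x - axis 1 z, y)) differentiable (at z)) \<and>
        (\<forall>z\<in>U. integrable Q (\<lambda>\<omega>.
          \<bar>G T (X T \<omega> + axis 1 (z + \<zeta>1 s0)) (Y T \<omega> + axis 1 (\<zeta>2 v0))\<bar>\<^sup>2)) \<and>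
        (AE (x, y) in lborel. \<forall>z\<in>U.
          \<bar>G T (x + axis 1 (\<zeta>1 s0)) (y + axis 1 (\<zeta>2 v0)) * partial_x1 g (x - axis 1 z, y)\<bar>
            \<le> \<phi> (x, y)))
      \<longrightarrow>
      integrable (completion Q) (\<lambda>\<omega>.
        G T (X T \<omega> + axis 1 (\<zeta>1 s0)) (Y T \<omega> + axis 1 (\<zeta>2 v0)) * partial_ln_x1 g (X T \<omega>, Y T \<omega>)) \<and>
      ((\<lambda>s. C s v0) has_real_derivative
        - deriv \<zeta>1 s0 * exp (- r * T) * expectation_as Q (\<lambda>\<omega>.
            G T (X T \<omega> + axis 1 (\<zeta>1 s0)) (Y T \<omega> + axis 1 (\<zeta>2 v0)) *
            partial_ln_x1 g (X T \<omega>, Y T \<omega>))) (at s0))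
     \<and>
     ((\<exists>U \<phi>. open U \<and> 0 \<in> U \<and> integrable lborel \<phi> \<and>
        (AE (x, y) in lborel. \<forall>z\<in>U. (\<lambda>z. g (x, y - axis 1 z)) differentiable (at z)) \<and>
        (\<forall>z\<in>U. integrable Q (\<lambda>\<omega>.
          \<bar>G T (X T \<omega> + axis 1 (\<zeta>1 s0)) (Y T \<omega> + axis 1 (z + \<zeta>2 v0))\<bar>\<^sup>2)) \<and>
        (AE (x, y) in lborel. \<forall>z\<in>U.
          \<bar>G T (x + axis 1 (\<zeta>1 s0)) (y + axis 1 (\<zeta>2 v0)) * partial_y1 g (x, y - axis 1 z)\<bar>
            \<le> \<phi> (x, y)))
      \<longrightarrow>
      integrable (completion Q) (\<lambda>\<omega>.
        G T (X T \<omega> + axis 1 (\<zeta>1 s0)) (Y T \<omega> + axis 1 (\<zeta>2 v0)) * partial_ln_y1 g (X T \<omega>, Y T \<omega>)) \<and>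
      ((\<lambda>v. C s0 v) has_real_derivative
        - deriv \<zeta>2 v0 * exp (- r * T) * expectation_as Q (\<lambda>\<omega>.
            G T (X T \<omega> + axis 1 (\<zeta>1 s0)) (Y T \<omega> + axis 1 (\<zeta>2 v0)) *
            partial_ln_y1 g (X T \<omega>, Y T \<omega>))) (at v0))"
proof -
  interpret filtered_prob_space Q F T by (rule filtered)
  let ?Z = "\<lambda>\<omega>. (X T \<omega>, Y T \<omega>)"
  \<comment> \<open>\<open>H\<close> absorbs the shifts at the actual initial values, so varying one
    of these leaves only the increment of \<open>\<zeta>1\<close> or \<open>\<zeta>2\<close> as a
    shift of the random vector.\<close>
  define H where "H = (\<lambda>p. G T (fst p + axis 1 (\<zeta>1 s0)) (snd p + axis 1 (\<zeta>2 v0)))"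
  have H_pair: "H (x, y) = G T (x + axis 1 (\<zeta>1 s0)) (y + axis 1 (\<zeta>2 v0))" for x y
    by (simp add: H_def)
  have [measurable]: "h1 \<in> borel_measurable (borel \<Otimes>\<^sub>M borel)"
      "h2 \<in> borel_measurable (borel \<Otimes>\<^sub>M borel)" "h \<in> borel_measurable (borel \<Otimes>\<^sub>M borel)"
    using h1_borel h2_borel h_borel by (simp_all add: borel_prod)
  have "H \<in> borel_measurable (borel \<Otimes>\<^sub>M borel)"
    unfolding H_def G_def by measurable
  then have H: "H \<in> borel_measurable borel" by (simp add: borel_prod)
  note deriv = shifted_expectation_has_derivative[OF g_density g_nonneg H]
  show ?thesis
  proof (rule conjI; rule impI; elim exE conjE)
    let ?e = "(axis 1 1, 0) :: (real ^ 'n::{finite,one}) \<times> (real ^ 'm::{finite,one})"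
    let ?W = "\<lambda>\<omega>. G T (X T \<omega> + axis 1 (\<zeta>1 s0)) (Y T \<omega> + axis 1 (\<zeta>2 v0)) *
      partial_ln_x1 g (X T \<omega>, Y T \<omega>)"
    have shift: "H (?Z \<omega> + z *\<^sub>R ?e) =
        G T (X T \<omega> + axis 1 (z + \<zeta>1 s0)) (Y T \<omega> + axis 1 (\<zeta>2 v0))" for \<omega> z
      by (simp add: H_pair axis_one_scaleR axis_add add.assoc)
    have W: "?W = (\<lambda>\<omega>. H (?Z \<omega>) * (line_deriv ?e g (?Z \<omega>) / g (?Z \<omega>)))"
      by (simp add: H_pair partial_ln_x1_def partial_x1_eq_line_deriv)
    \<comment> \<open>With \<open>z = \<zeta>1 s - \<zeta>1 s0\<close> in \<open>shift\<close>, the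
      base value cancels and \<open>\<zeta>1 s\<close> remains; the law of the factors at
      \<open>T\<close> is the same for every \<open>s\<close>.\<close>
    have C: "(\<lambda>s. C s v0) = (\<lambda>s. exp (- r * T) *
        expectation (\<lambda>\<omega>. H (?Z \<omega> + (\<zeta>1 s - \<zeta>1 s0) *\<^sub>R ?e)))"
      unfolding C_def shift by simp
    fix U \<phi>
    assume U: "open U" "0 \<in> U" "integrable lborel \<phi>"
      and diff: "AE (x, y) in lborel. \<forall>z\<in>U. (\<lambda>z. g (x - axis 1 z, y)) differentiable (at z)"
      and L2: "\<forall>z\<in>U. integrable Q (\<lambda>\<omega>.
          \<bar>G T (X T \<omega> + axis 1 (z + \<zeta>1 s0)) (Y T \<omega> + axis 1 (\<zeta>2 v0))\<bar>\<^sup>2)"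
      and bound: "AE (x, y) in lborel. \<forall>z\<in>U.
          \<bar>G T (x + axis 1 (\<zeta>1 s0)) (y + axis 1 (\<zeta>2 v0)) * partial_x1 g (x - axis 1 z, y)\<bar>
            \<le> \<phi> (x, y)"
    have diff': "AE p in lborel. \<forall>z\<in>U. (\<lambda>z. g (p - z *\<^sub>R ?e)) differentiable (at z)"
      using diff by (rule eventually_mono) (auto simp: axis_one_scaleR)
    have bound': "AE p in lborel. \<forall>z\<in>U. \<bar>H p * line_deriv ?e g (p - z *\<^sub>R ?e)\<bar> \<le> \<phi> p"
      using bound by (rule eventually_mono)
        (auto simp: axis_one_scaleR H_pair partial_x1_eq_line_deriv)
    note D = deriv[OF U diff' L2[folded shift] bound', folded W]
    show "integrable (completion Q) ?W \<and> ((\<lambda>s. C s v0) has_real_derivative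
        - deriv \<zeta>1 s0 * exp (- r * T) * expectation_as Q ?W) (at s0)"
      unfolding C by (intro conjI D(1) has_derivative_scaled_shift[OF \<zeta>1_diff D(2)])
  next
    let ?e = "(0, axis 1 1) :: (real ^ 'n::{finite,one}) \<times> (real ^ 'm::{finite,one})"
    let ?W = "\<lambda>\<omega>. G T (X T \<omega> + axis 1 (\<zeta>1 s0)) (Y T \<omega> + axis 1 (\<zeta>2 v0)) *
      partial_ln_y1 g (X T \<omega>, Y T \<omega>)"
    have shift: "H (?Z \<omega> + z *\<^sub>R ?e) =
        G T (X T \<omega> + axis 1 (\<zeta>1 s0)) (Y T \<omega> + axis 1 (z + \<zeta>2 v0))" for \<omega> z
      by (simp add: H_pair axis_one_scaleR axis_add add.assoc)
    have W: "?W = (\<lambda>\<omega>. H (?Z \<omega>) * (line_deriv ?e g (?Z \<omega>) / g (?Z \<omega>)))"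
      by (simp add: H_pair partial_ln_y1_def partial_y1_eq_line_deriv)
    have C: "(\<lambda>v. C s0 v) = (\<lambda>v. exp (- r * T) *
        expectation (\<lambda>\<omega>. H (?Z \<omega> + (\<zeta>2 v - \<zeta>2 v0) *\<^sub>R ?e)))"
      unfolding C_def shift by simp
    fix U \<phi>
    assume U: "open U" "0 \<in> U" "integrable lborel \<phi>"
      and diff: "AE (x, y) in lborel. \<forall>z\<in>U. (\<lambda>z. g (x, y - axis 1 z)) differentiable (at z)"
      and L2: "\<forall>z\<in>U. integrable Q (\<lambda>\<omega>.
          \<bar>G T (X T \<omega> + axis 1 (\<zeta>1 s0)) (Y T \<omega> + axis 1 (z + \<zeta>2 v0))\<bar>\<^sup>2)"
      and bound: "AE (x, y) in lborel. \<forall>z\<in>U.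
          \<bar>G T (x + axis 1 (\<zeta>1 s0)) (y + axis 1 (\<zeta>2 v0)) * partial_y1 g (x, y - axis 1 z)\<bar>
            \<le> \<phi> (x, y)"
    have diff': "AE p in lborel. \<forall>z\<in>U. (\<lambda>z. g (p - z *\<^sub>R ?e)) differentiable (at z)"
      using diff by (rule eventually_mono) (auto simp: axis_one_scaleR)
    have bound': "AE p in lborel. \<forall>z\<in>U. \<bar>H p * line_deriv ?e g (p - z *\<^sub>R ?e)\<bar> \<le> \<phi> p"
      using bound by (rule eventually_mono)
        (auto simp: axis_one_scaleR H_pair partial_y1_eq_line_deriv)
    note D = deriv[OF U diff' L2[folded shift] bound', folded W]
    show "integrable (completion Q) ?W \<and> ((\<lambda>v. C s0 v) has_real_derivative
        - deriv \<zeta>2 v0 * exp (- r * T) * expectation_as Q ?W) (at v0)"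
      unfolding C by (intro conjI D(1) has_derivative_scaled_shift[OF \<zeta>2_diff D(2)])
  qed
qed

end
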